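(* Let $N\ge 1$, let $\alpha\in(0,1)$, and consider testing $N$ independent null hypotheses $H_{01},\ldots,H_{0N}$ in the mixed-sample model with null distribution $F_0$, null proportion $\pi_0\in(0,1]$ and unknown non-null distribution $G$ (see context). Let $u_{(1)}\le\cdots\le u_{(N)}$ be the ordered p-values and $H_{(01)},\ldots,H_{(0N)}$ the correspondingly ordered null hypotheses. Define $$k=\max\Big\{1\le i\le N:\ \frac{\widetilde D(u_{(i)})}{u_{(i)}}\ \ge\ \frac{\pi_0}{\alpha}\Big\},\qquad \mathcal R=\{i: 1\le i\le k\},$$ with $\mathcal R=\emptyset$ if no such $i$ exists. Then the procedure that rejects $H_{(0i)}$ for exactly the indices $i\in\mathcal R$ controls the false discovery rate at level $\alpha$, i.e. $\mathrm{FDR}\le\alpha$, regardless of the distribution $G$ of the test statistics corresponding to false null hypotheses.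
   Context: Mixed-sample model: $Z_1,\ldots,Z_N$ are i.i.d. test statistics with continuous distribution function $F=\pi_0F_0+(1-\pi_0)G$, $0<\pi_0\le 1$, where $F_0$ is a known continuous distribution function and $G$ is unknown. That is, independently for each $i$, with probability $\pi_0$ the null hypothesis $H_{0i}$ is true and $Z_i\sim F_0$, and with probability $1-\pi_0$ it is false and $Z_i\sim G$. The p-values are $u_i=F_0(Z_i)$, so p-values of true nulls are uniform on $[0,1]$. Let $\widetilde F(z)=N^{-1}\sum_{i=1}^N \mathbb I(Z_i\le z)$ be the empirical distribution function and $\widetilde D(u)=\widetilde F(F_0^{-1}(u))$ the empirical comparison distribution function; at the ordered p-values it takes the value $\widetilde D(u_{(i)})=i/N$. If $u_{(i)}=0$ the ratio $\widetilde D(u_{(i)})/u_{(i)}$ is read as $+\infty$. The false discovery rate is the expected proportion of Type I errors among rejections: $\mathrm{FDR}=\mathbb E\big[V/\max(R,1)\big]$, where $R$ is the number of rejected hypotheses and $V$ the number of rejected hypotheses that are true nulls. *)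

theory Defs
  imports "HOL-Probability.Probability"
begin

text \<open>
  The laws \<open>F\<^sub>0\<close> and \<open>G\<close> are probability measures on the Borel sets of the reals; their distribution
  functions are \<open>cdf F\<^sub>0\<close> and \<open>cdf G\<close>.  \<open>H i \<omega>\<close> says that the \<open>i\<close>-th null hypothesis is true.  The
  law of a test statistic given that the null is false is constrained only if that event
  has positive probability; for \<open>\<pi>\<^sub>0 = 1\<close> the conditional probability would be \<open>0/0\<close>.
\<close>

locale mixed_sample = prob_space M + F0: real_distribution F0 + G: real_distribution G
  for M :: "'a measure" and N :: nat and \<pi>0 :: real and F0 G :: "real measure"
    and H :: "nat \<Rightarrow> 'a \<Rightarrow> bool" and Z :: "nat \<Rightarrow> 'a \<Rightarrow> real" +
  assumes pi0_pos: "0 < \<pi>0" and pi0_le_1: "\<pi>0 \<le> 1"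
    and continuous_F0: "\<And>z. isCont (cdf F0) z"
    and continuous_F: "\<And>z. isCont (\<lambda>t. \<pi>0 * cdf F0 t + (1 - \<pi>0) * cdf G t) z"
    and indep: "indep_vars (\<lambda>_. count_space UNIV \<Otimes>\<^sub>M borel) (\<lambda>i \<omega>. (H i \<omega>, Z i \<omega>)) {1..N}"
    and null_prob: "\<And>i. i \<in> {1..N} \<Longrightarrow> \<P>(\<omega> in M. H i \<omega>) = \<pi>0"
    and null_law: "\<And>i z. i \<in> {1..N} \<Longrightarrow> \<P>(\<omega> in M. Z i \<omega> \<le> z \<bar> H i \<omega>) = cdf F0 z"
    and nonnull_law: "\<And>i z. i \<in> {1..N} \<Longrightarrow> \<pi>0 < 1 \<Longrightarrow>
          \<P>(\<omega> in M. Z i \<omega> \<le> z \<bar> \<not> H i \<omega>) = cdf G z"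

definition p_value :: "real measure \<Rightarrow> (nat \<Rightarrow> real) \<Rightarrow> nat \<Rightarrow> real" where
  "p_value F0 z i = cdf F0 (z i)"

definition emp_cdf :: "nat \<Rightarrow> (nat \<Rightarrow> real) \<Rightarrow> ereal \<Rightarrow> real" where
  "emp_cdf N z t = (\<Sum>i = 1..N. if ereal (z i) \<le> t then 1 else 0) / real N"

text \<open>
  The generalised inverse of \<open>F\<^sub>0\<close> takes the largest solution of \<open>F\<^sub>0 z = u\<close>, and is \<open>\<infinity>\<close> or \<open>-\<infinity>\<close> where
  there is none.  Since \<open>G\<close> may charge sets on which \<open>F\<^sub>0\<close> is constant, the smallest solution
  would put too few observations below a p-value; with the largest one the comparison
  distribution function at a p-value is the proportion of p-values that do not exceed it
  (see \<open>emp_comparison_eq\<close> below).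
\<close>

definition cdf_inv :: "real measure \<Rightarrow> real \<Rightarrow> ereal" where
  "cdf_inv F0 u = Sup (ereal ` {x. cdf F0 x \<le> u})"

definition emp_comparison :: "nat \<Rightarrow> real measure \<Rightarrow> (nat \<Rightarrow> real) \<Rightarrow> real \<Rightarrow> real" where
  "emp_comparison N F0 z u = emp_cdf N z (cdf_inv F0 u)"

definition comparison_ratio :: "nat \<Rightarrow> real measure \<Rightarrow> (nat \<Rightarrow> real) \<Rightarrow> real \<Rightarrow> ereal" where
  "comparison_ratio N F0 z u = (if u = 0 then \<infinity> else ereal (emp_comparison N F0 z u / u))"

text \<open>
  \<open>\<sigma> i\<close> is the original index of the hypothesis with the \<open>i\<close>-th smallest p-value.  Ties may be
  broken in any way.
\<close>

definition is_ordering :: "nat \<Rightarrow> (nat \<Rightarrow> real) \<Rightarrow> (nat \<Rightarrow> nat) \<Rightarrow> bool" where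
  "is_ordering N u \<sigma> \<longleftrightarrow> bij_betw \<sigma> {1..N} {1..N} \<and> mono_on {1..N} (\<lambda>i. u (\<sigma> i))"

definition passing_ranks ::
  "nat \<Rightarrow> real \<Rightarrow> real \<Rightarrow> real measure \<Rightarrow> (nat \<Rightarrow> real) \<Rightarrow> (nat \<Rightarrow> nat) \<Rightarrow> nat set" where
  "passing_ranks N \<pi>0 \<alpha> F0 z \<sigma> =
     {i \<in> {1..N}. comparison_ratio N F0 z (p_value F0 z (\<sigma> i)) \<ge> ereal (\<pi>0 / \<alpha>)}"

definition rejected_ranks ::
  "nat \<Rightarrow> real \<Rightarrow> real \<Rightarrow> real measure \<Rightarrow> (nat \<Rightarrow> real) \<Rightarrow> (nat \<Rightarrow> nat) \<Rightarrow> nat set" where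
  "rejected_ranks N \<pi>0 \<alpha> F0 z \<sigma> =
     (let S = passing_ranks N \<pi>0 \<alpha> F0 z \<sigma> in if S = {} then {} else {1..Max S})"

definition rejected ::
  "nat \<Rightarrow> real \<Rightarrow> real \<Rightarrow> real measure \<Rightarrow> (nat \<Rightarrow> real) \<Rightarrow> (nat \<Rightarrow> nat) \<Rightarrow> nat set" where
  "rejected N \<pi>0 \<alpha> F0 z \<sigma> = \<sigma> ` rejected_ranks N \<pi>0 \<alpha> F0 z \<sigma>"

definition fdp :: "(nat \<Rightarrow> bool) \<Rightarrow> nat set \<Rightarrow> real" where
  "fdp h R = real (card {i \<in> R. h i}) / real (max (card R) 1)"

definition FDR :: "'a measure \<Rightarrow> (nat \<Rightarrow> 'a \<Rightarrow> bool) \<Rightarrow> ('a \<Rightarrow> nat set) \<Rightarrow> real" where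
  "FDR M H R = (\<integral>\<omega>. fdp (\<lambda>i. H i \<omega>) (R \<omega>) \<partial>M)"

lemma (in real_distribution) le_cdf_inv_iff:
  assumes "\<And>z. isCont (cdf M) z"
  shows "ereal z \<le> cdf_inv M u \<longleftrightarrow> cdf M z \<le> u"
proof
  assume "cdf M z \<le> u"
  then show "ereal z \<le> cdf_inv M u"
    unfolding cdf_inv_def by (intro Sup_upper) auto
next
  assume le: "ereal z \<le> cdf_inv M u"
  show "cdf M z \<le> u"
  proof (rule ccontr)
    assume "\<not> cdf M z \<le> u"
    then have "eventually (\<lambda>y. cdf M y > u) (at z)"
      using assms[of z] unfolding isCont_def by (intro order_tendstoD) auto
    then obtain d where d: "d > 0" "\<And>y. y \<noteq> z \<Longrightarrow> dist y z < d \<Longrightarrow> cdf M y > u"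
      unfolding eventually_at by blast
    have x: "cdf M (z - d/2) > u" using d by (auto simp: dist_real_def)
    have "cdf_inv M u \<le> ereal (z - d/2)"
      unfolding cdf_inv_def
    proof (rule Sup_least)
      fix y assume "y \<in> ereal ` {x. cdf M x \<le> u}"
      then obtain w where w: "y = ereal w" "cdf M w \<le> u" by auto
      have "w \<le> z - d/2"
        using w x cdf_nondecreasing[of "z - d/2" w] by linarith
      then show "y \<le> ereal (z - d/2)" using w by simp
    qed
    then have "ereal z \<le> ereal (z - d/2)" using le by order
    then show False using d by simp
  qed
qed

lemma (in mixed_sample) emp_comparison_eq:
  "emp_comparison N F0 z u = real (card {i \<in> {1..N}. p_value F0 z i \<le> u}) / real N"
proof -
  have "(\<Sum>i = 1..N. if cdf F0 (z i) \<le> u then 1 else 0 :: real) =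
        real (card {i \<in> {1..N}. cdf F0 (z i) \<le> u})"
    by (subst sum.inter_filter[symmetric]) auto
  then show ?thesis
    by (simp add: emp_comparison_def emp_cdf_def F0.le_cdf_inv_iff[OF continuous_F0] p_value_def)
qed

text \<open>
  The ratio may be formed with \<open>i / N\<close> in place of the comparison distribution function at the
  \<open>i\<close>-th ordered p-value, also when p-values are tied.
\<close>

lemma (in mixed_sample) rejected_ranks_eq:
  assumes "is_ordering N (p_value F0 z) \<sigma>"
  shows "rejected_ranks N \<pi>0 \<alpha> F0 z \<sigma> =
    (let S = {i \<in> {1..N}. (if p_value F0 z (\<sigma> i) = 0 then \<infinity>
                             else ereal ((real i / real N) / p_value F0 z (\<sigma> i))) \<ge> ereal (\<pi>0 / \<alpha>)}
     in if S = {} then {} else {1..Max S})"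
proof -
  define u where "u = p_value F0 z"
  define P where "P = passing_ranks N \<pi>0 \<alpha> F0 z \<sigma>"
  define S where "S = {i \<in> {1..N}. (if u (\<sigma> i) = 0 then \<infinity>
                             else ereal ((real i / real N) / u (\<sigma> i))) \<ge> ereal (\<pi>0 / \<alpha>)}"
  have bij: "bij_betw \<sigma> {1..N} {1..N}"
    and mono: "\<And>i j. i \<in> {1..N} \<Longrightarrow> j \<in> {1..N} \<Longrightarrow> i \<le> j \<Longrightarrow> u (\<sigma> i) \<le> u (\<sigma> j)"
    using assms by (auto simp: is_ordering_def u_def mono_on_def)
  have u0: "u i \<ge> 0" for i by (simp add: u_def p_value_def cdf_def)
  have D: "emp_comparison N F0 z (u j) = real (card {i \<in> {1..N}. u i \<le> u j}) / real N" for j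
    by (simp add: emp_comparison_eq u_def)
  have sub1: "\<sigma> ` {1..i} \<subseteq> {l \<in> {1..N}. u l \<le> u (\<sigma> i)}" if "i \<in> {1..N}" for i
    using that mono bij unfolding bij_betw_def by fastforce
  have cardi: "card (\<sigma> ` {1..i}) = i" if "i \<in> {1..N}" for i
  proof -
    have "inj_on \<sigma> {1..i}" using bij that unfolding bij_betw_def by (auto intro: inj_on_subset)
    then show ?thesis by (simp add: card_image)
  qed
  have ge: "i \<le> card {l \<in> {1..N}. u l \<le> u (\<sigma> i)}" if "i \<in> {1..N}" for i
    using card_mono[OF _ sub1[OF that]] cardi[OF that] by simp
  have P_eq: "P = {i \<in> {1..N}. (if u (\<sigma> i) = 0 then \<infinity>
        else ereal ((real (card {l \<in> {1..N}. u l \<le> u (\<sigma> i)}) / real N) / u (\<sigma> i))) \<ge> ereal (\<pi>0 / \<alpha>)}"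
    by (simp add: P_def passing_ranks_def comparison_ratio_def u_def[symmetric] D)
  have SP: "S \<subseteq> P"
  proof
    fix i assume i: "i \<in> S"
    then have iN: "i \<in> {1..N}" by (simp add: S_def)
    have "(real i / real N) / u (\<sigma> i)
        \<le> (real (card {l \<in> {1..N}. u l \<le> u (\<sigma> i)}) / real N) / u (\<sigma> i)"
      using ge[OF iN] u0[of "\<sigma> i"] by (intro divide_right_mono) auto
    then show "i \<in> P"
      using i unfolding P_eq S_def by (auto split: if_splits intro: order_trans)
  qed
  have finP: "finite P" by (simp add: P_eq)
  have MaxS: "Max P \<in> S" if "P \<noteq> {}"
  proof -
    define m where "m = Max P"
    have m: "m \<in> P" using that finP by (simp add: m_def)
    have m_ge: "i \<le> m" if "i \<in> P" for i using that finP by (simp add: m_def)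
    have mN: "m \<in> {1..N}" using m by (simp add: P_eq)
    have "{l \<in> {1..N}. u l \<le> u (\<sigma> m)} \<subseteq> \<sigma> ` {1..m}"
    proof
      fix l assume l: "l \<in> {l \<in> {1..N}. u l \<le> u (\<sigma> m)}"
      then obtain i where i: "i \<in> {1..N}" "l = \<sigma> i" using bij unfolding bij_betw_def by blast
      have "i \<le> m"
      proof (rule ccontr)
        assume "\<not> i \<le> m"
        then have "u (\<sigma> i) = u (\<sigma> m)" using mono[of m i] l i mN by force
        then have "i \<in> P" using m i unfolding P_eq mem_Collect_eq by metis
        then show False using \<open>\<not> i \<le> m\<close> m_ge by blast
      qed
      then show "l \<in> \<sigma> ` {1..m}" using i by simp
    qed
    then have "card {l \<in> {1..N}. u l \<le> u (\<sigma> m)} = m"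
      using sub1[OF mN] cardi[OF mN] by (metis subset_antisym)
    then have "m \<in> S" using m unfolding P_eq S_def mem_Collect_eq by metis
    then show ?thesis by (simp only: m_def)
  qed
  have "rejected_ranks N \<pi>0 \<alpha> F0 z \<sigma> = (if P = {} then {} else {1..Max P})"
    by (simp add: rejected_ranks_def P_def Let_def)
  also have "\<dots> = (if S = {} then {} else {1..Max S})"
  proof (cases "P = {}")
    case True
    then show ?thesis using SP by simp
  next
    case False
    have "Max S = Max P"
      using MaxS[OF False] SP finP finite_subset[OF SP finP]
      by (metis Max_eqI Max_ge subsetD)
    then show ?thesis using False MaxS[OF False] by auto
  qed
  finally show ?thesis unfolding S_def u_def Let_def .
qed

lemma (in mixed_sample) rejected_eq:
  assumes "is_ordering N (p_value F0 z) \<sigma>"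
  shows "rejected N \<pi>0 \<alpha> F0 z \<sigma> = {i \<in> {1..N}. \<exists>j \<in> {1..N}. p_value F0 z i \<le> p_value F0 z j \<and>
    comparison_ratio N F0 z (p_value F0 z j) \<ge> ereal (\<pi>0 / \<alpha>)}" (is "_ = ?R")
proof -
  define P where "P = passing_ranks N \<pi>0 \<alpha> F0 z \<sigma>"
  have bij: "bij_betw \<sigma> {1..N} {1..N}"
    and mono: "\<And>i j. i \<in> {1..N} \<Longrightarrow> j \<in> {1..N} \<Longrightarrow> i \<le> j \<Longrightarrow> p_value F0 z (\<sigma> i) \<le> p_value F0 z (\<sigma> j)"
    using assms by (auto simp: is_ordering_def mono_on_def)
  have finP: "finite P" and PN: "P \<subseteq> {1..N}" by (auto simp: P_def passing_ranks_def)
  have "rejected N \<pi>0 \<alpha> F0 z \<sigma> = \<sigma> ` (if P = {} then {} else {1..Max P})"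
    by (simp add: rejected_def rejected_ranks_def P_def Let_def)
  also have "\<dots> = ?R"
  proof (intro equalityI subsetI)
    fix x assume "x \<in> \<sigma> ` (if P = {} then {} else {1..Max P})"
    then have ne: "P \<noteq> {}" and x: "x \<in> \<sigma> ` {1..Max P}" by (auto split: if_splits)
    from x obtain i where i: "1 \<le> i" "i \<le> Max P" "x = \<sigma> i"
      by (metis atLeastAtMost_iff imageE)
    have m: "Max P \<in> P" using ne finP by simp
    with PN have mN: "Max P \<in> {1..N}" by blast
    with i have iN: "i \<in> {1..N}" by auto
    have "\<sigma> i \<in> {1..N}" "\<sigma> (Max P) \<in> {1..N}"
      using bij iN mN unfolding bij_betw_def by blast+
    moreover have "p_value F0 z (\<sigma> i) \<le> p_value F0 z (\<sigma> (Max P))" using mono iN mN i by blast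
    moreover have "comparison_ratio N F0 z (p_value F0 z (\<sigma> (Max P))) \<ge> ereal (\<pi>0 / \<alpha>)"
      using m by (simp add: P_def passing_ranks_def)
    ultimately show "x \<in> ?R" using i by blast
  next
    fix x assume "x \<in> ?R"
    then obtain j where xN: "x \<in> {1..N}" and jN: "j \<in> {1..N}"
      and le: "p_value F0 z x \<le> p_value F0 z j"
      and j: "comparison_ratio N F0 z (p_value F0 z j) \<ge> ereal (\<pi>0 / \<alpha>)" by blast
    from xN jN bij obtain a b where ab: "a \<in> {1..N}" "x = \<sigma> a" "b \<in> {1..N}" "j = \<sigma> b"
      unfolding bij_betw_def by (metis imageE)
    have b: "b \<in> P" using ab j by (simp add: P_def passing_ranks_def)
    have "a \<le> Max P"
    proof (cases "a \<le> b")
      case True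
      then show ?thesis using b finP Max_ge order_trans by blast
    next
      case False
      then have "p_value F0 z (\<sigma> a) = p_value F0 z (\<sigma> b)"
        using mono[of b a] ab le by force
      then have "a \<in> P" using b ab by (simp add: P_def passing_ranks_def)
      then show ?thesis using finP Max_ge by blast
    qed
    then show "x \<in> \<sigma> ` (if P = {} then {} else {1..Max P})" using b ab by auto
  qed
  finally show ?thesis .
qed

text \<open>
  The false discovery proportion is integrable, so its Bochner integral in \<open>FDR\<close> is a genuine
  expectation, no matter how ties are broken.
\<close>

lemma (in mixed_sample) integrable_fdp:
  assumes ord: "\<And>\<omega>. \<omega> \<in> space M \<Longrightarrow> is_ordering N (p_value F0 (\<lambda>i. Z i \<omega>)) (\<sigma> \<omega>)"
  shows "integrable M (\<lambda>\<omega>. fdp (\<lambda>i. H i \<omega>) (rejected N \<pi>0 \<alpha> F0 (\<lambda>i. Z i \<omega>) (\<sigma> \<omega>)))"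
proof -
  have rv: "(\<lambda>\<omega>. (H i \<omega>, Z i \<omega>)) \<in> M \<rightarrow>\<^sub>M count_space UNIV \<Otimes>\<^sub>M borel" if "i \<in> {1..N}" for i
    using indep that unfolding indep_vars_def by blast
  have H[measurable]: "H i \<in> M \<rightarrow>\<^sub>M count_space UNIV" if "i \<in> {1..N}" for i
    using measurable_compose[OF rv[OF that] measurable_fst] by simp
  have Z[measurable]: "Z i \<in> borel_measurable M" if "i \<in> {1..N}" for i
    using measurable_compose[OF rv[OF that] measurable_snd] by simp
  have "cdf F0 \<in> borel_measurable borel"
    using continuous_F0 by (intro borel_measurable_continuous_onI continuous_at_imp_continuous_on) auto
  note [measurable] = this
  define U where "U i \<omega> = cdf F0 (Z i \<omega>)" for i \<omega>
  have U[measurable]: "U i \<in> borel_measurable M" if "i \<in> {1..N}" for i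
    unfolding U_def using that by measurable
  define D where "D j \<omega> = (\<Sum>i = 1..N. if U i \<omega> \<le> U j \<omega> then 1 else 0 :: real) / real N" for j \<omega>
  have D[measurable]: "D j \<in> borel_measurable M" if "j \<in> {1..N}" for j
    unfolding D_def using that
    by (intro borel_measurable_divide borel_measurable_sum borel_measurable_const) measurable
  define A where "A i \<omega> \<longleftrightarrow> (\<exists>j\<in>{1..N}. U i \<omega> \<le> U j \<omega> \<and>
      (U j \<omega> = 0 \<or> \<pi>0 / \<alpha> \<le> D j \<omega> / U j \<omega>))" for i \<omega>
  have A[measurable]: "Measurable.pred M (A i)" if "i \<in> {1..N}" for i
    unfolding A_def using that by (intro pred_intros_finite) measurable
  define V where "V \<omega> = (\<Sum>i = 1..N. if A i \<omega> \<and> H i \<omega> then 1 else 0 :: real)" for \<omega>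
  define R where "R \<omega> = (\<Sum>i = 1..N. if A i \<omega> then 1 else 0 :: real)" for \<omega>
  have meas: "(\<lambda>\<omega>. V \<omega> / max (R \<omega>) 1) \<in> borel_measurable M"
    unfolding V_def R_def
    by (intro borel_measurable_divide borel_measurable_max borel_measurable_sum
        borel_measurable_const) measurable
  have eq: "fdp (\<lambda>i. H i \<omega>) (rejected N \<pi>0 \<alpha> F0 (\<lambda>i. Z i \<omega>) (\<sigma> \<omega>)) = V \<omega> / max (R \<omega>) 1"
    if "\<omega> \<in> space M" for \<omega>
  proof -
    have D_eq: "D j \<omega> = emp_comparison N F0 (\<lambda>i. Z i \<omega>) (U j \<omega>)" for j
      by (simp add: D_def emp_comparison_def emp_cdf_def F0.le_cdf_inv_iff[OF continuous_F0] U_def)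
    have ratio_iff: "comparison_ratio N F0 z v \<ge> ereal c \<longleftrightarrow> v = 0 \<or> c \<le> emp_comparison N F0 z v / v"
      for z v c by (simp add: comparison_ratio_def)
    have "rejected N \<pi>0 \<alpha> F0 (\<lambda>i. Z i \<omega>) (\<sigma> \<omega>) = {i \<in> {1..N}. A i \<omega>}"
      unfolding rejected_eq[OF ord[OF that]] A_def D_eq p_value_def U_def ratio_iff ..
    moreover have "V \<omega> = real (card {i \<in> {1..N}. A i \<omega> \<and> H i \<omega>})"
      unfolding V_def by (subst sum.inter_filter[symmetric]) auto
    moreover have "R \<omega> = real (card {i \<in> {1..N}. A i \<omega>})"
      unfolding R_def by (subst sum.inter_filter[symmetric]) auto
    moreover have "{i \<in> {i \<in> {1..N}. A i \<omega>}. H i \<omega>} = {i \<in> {1..N}. A i \<omega> \<and> H i \<omega>}" by auto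
    ultimately show ?thesis by (simp add: fdp_def of_nat_max)
  qed
  have bound: "fdp h S \<le> 1" if "finite S" for h S
  proof -
    have "card {i \<in> S. h i} \<le> card S" using that by (intro card_mono) auto
    then show ?thesis unfolding fdp_def by (simp add: divide_le_eq le_max_iff_disj)
  qed
  show ?thesis
  proof (rule integrable_const_bound[where B = 1])
    show "AE \<omega> in M. norm (fdp (\<lambda>i. H i \<omega>) (rejected N \<pi>0 \<alpha> F0 (\<lambda>i. Z i \<omega>) (\<sigma> \<omega>))) \<le> 1"
    proof (rule AE_I2)
      fix \<omega> assume "\<omega> \<in> space M"
      then have "finite (rejected N \<pi>0 \<alpha> F0 (\<lambda>i. Z i \<omega>) (\<sigma> \<omega>))"
        by (simp add: rejected_eq[OF ord])
      then show "norm (fdp (\<lambda>i. H i \<omega>) (rejected N \<pi>0 \<alpha> F0 (\<lambda>i. Z i \<omega>) (\<sigma> \<omega>))) \<le> 1"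
        using bound by (simp add: fdp_def)
    qed
    show "(\<lambda>\<omega>. fdp (\<lambda>i. H i \<omega>) (rejected N \<pi>0 \<alpha> F0 (\<lambda>i. Z i \<omega>) (\<sigma> \<omega>))) \<in> borel_measurable M"
      using meas by (subst measurable_cong[OF eq]) auto
  qed
qed

end

theory Submission
  imports Defs
begin

text \<open>
  Benjamini--Hochberg by leave-one-out.  With \<open>c = \<alpha> / (\<pi>\<^sub>0 N)\<close> the procedure rejects every p-value that
  is at most some level \<open>t\<close> with \<open>t \<le> c #{l. u l \<le> t}\<close>.  If \<open>i\<close> is rejected, replacing \<open>u i\<close> by \<open>0\<close>
  does not change the rejected set, so the number of rejections equals a number \<open>r i \<ge> 1\<close> that depends
  only on the other observations, and \<open>u i \<le> c (r i)\<close>.  By independence and the uniformity of null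
  p-values, hypothesis \<open>i\<close> contributes at most \<open>E (\<pi>\<^sub>0 c (r i) / r i) = \<alpha> / N\<close> to the false discovery rate.
\<close>

section \<open>Deterministic step-up selection on a finite family of numbers\<close>

text \<open>Admitting every real level \<open>t\<close>, not only the values of \<open>u\<close>,
  lets a passing level be kept while the values of \<open>u\<close> are altered, which is what the
  comparison lemmas below do.\<close>

definition step_up :: "'i set \<Rightarrow> real \<Rightarrow> ('i \<Rightarrow> real) \<Rightarrow> 'i set" where
  "step_up I c u = {i \<in> I. \<exists>t. u i \<le> t \<and> t \<le> c * real (card {l \<in> I. u l \<le> t})}"

lemma step_up_subset: "step_up I c u \<subseteq> I"
  by (auto simp: step_up_def)

text \<open>A passing level can be lowered to the largest value of \<open>u\<close> below it: the
  count stays the same and the level only gets smaller. The finite quantifier matches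
  \<open>rejected_eq\<close> and gives measurability.\<close>

lemma step_up_eq:
  assumes fin: "finite I"
  shows "step_up I c u =
    {i \<in> I. \<exists>j\<in>I. u i \<le> u j \<and> u j \<le> c * real (card {l \<in> I. u l \<le> u j})}" (is "_ = ?R")
proof (intro equalityI subsetI)
  fix i assume "i \<in> step_up I c u"
  then obtain t where i: "i \<in> I" and t: "u i \<le> t" "t \<le> c * real (card {l \<in> I. u l \<le> t})"
    by (auto simp: step_up_def)
  define S where "S = {l \<in> I. u l \<le> t}"
  have S: "finite (u ` S)" "u i \<in> u ` S" using fin i t by (auto simp: S_def)
  then have "Max (u ` S) \<in> u ` S" by (intro Max_in) auto
  then obtain j where j: "j \<in> S" "u j = Max (u ` S)" by auto
  have max: "u l \<le> u j" if "l \<in> S" for l using j S that by simp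
  have "{l \<in> I. u l \<le> u j} = S" using max j by (auto simp: S_def)
  moreover have "u j \<le> t" using j by (simp add: S_def)
  ultimately have "u j \<le> c * real (card {l \<in> I. u l \<le> u j})" using t by (simp add: S_def)
  moreover have "i \<in> S" using i t by (simp add: S_def)
  moreover have "j \<in> I" using j by (simp add: S_def)
  ultimately show "i \<in> ?R" using i max by blast
qed (auto simp: step_up_def)

text \<open>All indices counted at a passing level are selected through that same level, so the
  count there is at most the total number of selections.\<close>

lemma le_step_up:
  assumes "finite I" "0 \<le> c" "i \<in> step_up I c u"
  shows "u i \<le> c * real (card (step_up I c u))"
proof -
  obtain t where t: "u i \<le> t" "t \<le> c * real (card {l \<in> I. u l \<le> t})"
    using assms(3) by (auto simp: step_up_def)
  have "{l \<in> I. u l \<le> t} \<subseteq> step_up I c u"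
    using t by (auto simp: step_up_def)
  then have "card {l \<in> I. u l \<le> t} \<le> card (step_up I c u)"
    using finite_subset[OF step_up_subset assms(1)] by (intro card_mono) auto
  then have "c * real (card {l \<in> I. u l \<le> t}) \<le> c * real (card (step_up I c u))"
    using assms(2) by (intro mult_left_mono) auto
  then show ?thesis using t by linarith
qed

text \<open>Lowering values can only increase the count at each level, so a level that passes for
  \<open>u\<close> still passes for \<open>v\<close>.\<close>

lemma step_up_antimono:
  assumes fin: "finite I" and c: "0 \<le> c" and le: "\<And>l. v l \<le> u l"
  shows "step_up I c u \<subseteq> step_up I c v"
proof
  fix k assume "k \<in> step_up I c u"
  then obtain t where k: "k \<in> I" and t: "u k \<le> t" "t \<le> c * real (card {l \<in> I. u l \<le> t})"
    by (auto simp: step_up_def)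
  have "card {l \<in> I. u l \<le> t} \<le> card {l \<in> I. v l \<le> t}"
    using fin le order_trans by (intro card_mono) auto
  then have "c * real (card {l \<in> I. u l \<le> t}) \<le> c * real (card {l \<in> I. v l \<le> t})"
    using c by (intro mult_left_mono) auto
  then have "v k \<le> t" "t \<le> c * real (card {l \<in> I. v l \<le> t})"
    using t le[of k] by linarith+
  then show "k \<in> step_up I c v" using k by (auto simp: step_up_def)
qed

text \<open>Only the loss of selections has to be excluded when \<open>0\<close> is changed back to
  \<open>u i\<close>. Let \<open>s\<close> be a level that selects \<open>i\<close> under
  \<open>u\<close>. A new level \<open>t\<close> up to \<open>s\<close> can be replaced by
  \<open>s\<close>; above \<open>s\<close> the change in coordinate \<open>i\<close> is invisible to
  the count.\<close>

lemma step_up_leave_one_out: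
  assumes fin: "finite I" and c: "0 \<le> c" and ui: "0 \<le> u i" and i: "i \<in> step_up I c u"
  shows "step_up I c (u(i := 0)) = step_up I c u"
proof (intro equalityI subsetI)
  obtain s where s: "u i \<le> s" "s \<le> c * real (card {l \<in> I. u l \<le> s})"
    using i by (auto simp: step_up_def)
  fix k assume "k \<in> step_up I c (u(i := 0))"
  then obtain t where k: "k \<in> I" and t: "(u(i := 0)) k \<le> t"
      "t \<le> c * real (card {l \<in> I. (u(i := 0)) l \<le> t})"
    by (auto simp: step_up_def)
  show "k \<in> step_up I c u"
  proof (cases "k = i")
    case True
    then show ?thesis using i by simp
  next
    case False
    then have uk: "u k \<le> t" using t by simp
    show ?thesis
    proof (cases "t \<le> s")
      case True
      then have "u k \<le> s" using uk by simp
      then show ?thesis using k s by (auto simp: step_up_def)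
    next
      case False
      \<comment> \<open>Here 0 \<le> \<open>u i\<close> \<le> \<open>s\<close> < \<open>t\<close>,
        so \<open>i\<close> is counted on both sides.\<close>
      then have "{l \<in> I. (u(i := 0)) l \<le> t} = {l \<in> I. u l \<le> t}" using s ui by auto
      then have "t \<le> c * real (card {l \<in> I. u l \<le> t})" using t(2) by (simp only:)
      then show ?thesis using k uk unfolding step_up_def by blast
    qed
  qed
next
  fix k assume k: "k \<in> step_up I c u"
  have "(u(i := 0)) l \<le> u l" for l using ui by simp
  then have "step_up I c u \<subseteq> step_up I c (u(i := 0))" by (rule step_up_antimono[OF fin c])
  then show "k \<in> step_up I c (u(i := 0))" using k by blast
qed

text \<open>The definition quantifies over uncountably many levels; \<open>step_up_eq\<close>
  reduces this to a finite disjunction of measurable comparisons.\<close>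

lemma measurable_card_step_up:
  assumes u: "\<And>j. j \<in> I \<Longrightarrow> (\<lambda>x. u x j) \<in> borel_measurable A" and fin: "finite I"
  shows "(\<lambda>x. real (card (step_up I c (u x)))) \<in> borel_measurable A"
proof -
  note [measurable] = u
  have card_eq: "real (card {j \<in> I. P j}) = (\<Sum>j\<in>I. if P j then 1 else 0)" for P
    using fin by (subst sum.inter_filter[symmetric]) auto
  have D[measurable]: "(\<lambda>x. \<Sum>l\<in>I. if u x l \<le> u x j then 1 else 0 :: real) \<in> borel_measurable A"
    if "j \<in> I" for j
    using that by (intro borel_measurable_sum) measurable
  have "Measurable.pred A (\<lambda>x. \<exists>j\<in>I. u x i \<le> u x j \<and>
      u x j \<le> c * (\<Sum>l\<in>I. if u x l \<le> u x j then 1 else 0))" if "i \<in> I" for i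
    using that fin by (intro pred_intros_finite) measurable
  then show ?thesis
    unfolding step_up_eq[OF fin] card_eq
    by (intro borel_measurable_sum measurable_If measurable_const) auto
qed

section \<open>Measurability and the law of null p-values\<close>

context mixed_sample
begin

lemma measurable_sample:
  "i \<in> {1..N} \<Longrightarrow> (\<lambda>\<omega>. (H i \<omega>, Z i \<omega>)) \<in> M \<rightarrow>\<^sub>M count_space UNIV \<Otimes>\<^sub>M borel"
  using indep unfolding indep_vars_def by blast

lemma measurable_null: "i \<in> {1..N} \<Longrightarrow> H i \<in> M \<rightarrow>\<^sub>M count_space UNIV"
  using measurable_compose[OF measurable_sample measurable_fst] by simp

lemma measurable_stat: "i \<in> {1..N} \<Longrightarrow> Z i \<in> borel_measurable M"
  using measurable_compose[OF measurable_sample measurable_snd] by simp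

lemma measurable_cdf_F0: "cdf F0 \<in> borel_measurable borel"
  using continuous_F0 by (intro borel_measurable_continuous_onI continuous_at_imp_continuous_on) auto

text \<open>\<open>cdf F0\<close> may have flat stretches, so it is not inverted. By continuity the
  sublevel set at \<open>t\<close> is closed and, when nonempty and bounded above, contains its
  supremum; \<open>null_law\<close> is applied at that point.\<close>

lemma prob_null_p_value_le:
  assumes i: "i \<in> {1..N}" and t: "0 \<le> t"
  shows "\<P>(\<omega> in M. H i \<omega> \<and> cdf F0 (Z i \<omega>) \<le> t) \<le> \<pi>0 * t"
proof -
  note [measurable] = measurable_null[OF i] measurable_stat[OF i] measurable_cdf_F0
  show ?thesis
  proof (cases "1 \<le> t")
    \<comment> \<open>Levels above 1 do occur: the lemma is applied at \<open>c * real r\<close>,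
      which can exceed 1 when \<alpha> > \<pi>0. The sublevel set is then the whole line and has no
      supremum.\<close>
    case True
    have "\<P>(\<omega> in M. H i \<omega> \<and> cdf F0 (Z i \<omega>) \<le> t) \<le> \<P>(\<omega> in M. H i \<omega>)"
      by (intro finite_measure_mono) auto
    also have "\<dots> \<le> \<pi>0 * t" using null_prob[OF i] pi0_pos True by simp
    finally show ?thesis .
  next
    case False
    define S where "S = {x. cdf F0 x \<le> t}"
    show ?thesis
    proof (cases "S = {}")
      case True
      then have "\<not> cdf F0 x \<le> t" for x by (auto simp: S_def)
      then show ?thesis using t pi0_pos by simp
    next
      case ne: False
      have "eventually (\<lambda>x. t < cdf F0 x) at_top"
        using F0.cdf_lim_at_top_prob False by (intro order_tendstoD(1)) auto
      then obtain b where b: "\<And>x. b \<le> x \<Longrightarrow> t < cdf F0 x"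
        by (auto simp: eventually_at_top_linorder)
      have bdd: "bdd_above S"
      proof (rule bdd_aboveI)
        show "x \<le> b" if "x \<in> S" for x
          using b[of x] that by (force simp: S_def)
      qed
      have "closed S"
        unfolding S_def using continuous_F0
        by (intro closed_Collect_le continuous_at_imp_continuous_on) auto
      then have "Sup S \<in> S" using ne bdd by (intro closed_contains_Sup)
      then have s: "cdf F0 (Sup S) \<le> t" by (simp add: S_def)
      have "\<P>(\<omega> in M. H i \<omega> \<and> cdf F0 (Z i \<omega>) \<le> t) \<le> \<P>(\<omega> in M. Z i \<omega> \<le> Sup S \<and> H i \<omega>)"
        using bdd by (intro finite_measure_mono) (auto simp: S_def intro: cSup_upper)
      also have "\<dots> = \<pi>0 * cdf F0 (Sup S)"
        using null_law[OF i, of "Sup S"] null_prob[OF i] pi0_pos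
        by (simp add: cond_prob_def field_simps)
      also have "\<dots> \<le> \<pi>0 * t" using s pi0_pos by simp
      finally show ?thesis .
    qed
  qed
qed

section \<open>The rejection count with one p-value set to zero, and its independence of that
  observation\<close>

text \<open>This is the \<open>r i\<close> of the proof idea, real-valued so that it is a Borel
  random variable.\<close>

definition rejections_at_zero :: "nat \<Rightarrow> real \<Rightarrow> 'a \<Rightarrow> real" where
  "rejections_at_zero i c \<omega> = real (card (step_up {1..N} c ((\<lambda>j. cdf F0 (Z j \<omega>))(i := 0))))"

lemma measurable_rejections_at_zero: "rejections_at_zero i c \<in> borel_measurable M"
  unfolding rejections_at_zero_def
proof (rule measurable_card_step_up)
  fix j assume "j \<in> {1..N}"
  then show "(\<lambda>\<omega>. ((\<lambda>j. cdf F0 (Z j \<omega>))(i := 0)) j) \<in> borel_measurable M"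
    using measurable_compose[OF measurable_stat measurable_cdf_F0] by (cases "j = i") auto
qed simp

text \<open>The first event is a function of the pair (\<open>H i\<close>, \<open>Z i\<close>)
  alone, the second of the pairs with index in \<open>J\<close>; disjoint blocks of an independent
  family are independent.\<close>

lemma prob_null_rejections_at_zero:
  assumes i: "i \<in> {1..N}"
  shows "\<P>(\<omega> in M. (H i \<omega> \<and> cdf F0 (Z i \<omega>) \<le> t) \<and> rejections_at_zero i c \<omega> = r) =
    \<P>(\<omega> in M. H i \<omega> \<and> cdf F0 (Z i \<omega>) \<le> t) * \<P>(\<omega> in M. rejections_at_zero i c \<omega> = r)"
proof -
  let ?B = "count_space UNIV \<Otimes>\<^sub>M borel :: (bool \<times> real) measure"
  let ?X = "\<lambda>j \<omega>. (H j \<omega>, Z j \<omega>)"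
  define J where "J = {1..N} - {i}"
  define f where "f w = (if fst (w i) \<and> cdf F0 (snd (w i)) \<le> t then 1 else 0 :: real)"
    for w :: "nat \<Rightarrow> bool \<times> real"
  define g where "g w = real (card (step_up {1..N} c ((\<lambda>j. cdf F0 (snd (w j)))(i := 0))))"
    for w :: "nat \<Rightarrow> bool \<times> real"
  note [measurable] = measurable_cdf_F0
  have [measurable]: "(\<lambda>w. w i) \<in> PiM {i} (\<lambda>_. ?B) \<rightarrow>\<^sub>M ?B"
    by (intro measurable_component_singleton) simp
  have f: "f \<in> borel_measurable (PiM {i} (\<lambda>_. ?B))"
    unfolding f_def by measurable
  have g: "g \<in> borel_measurable (PiM J (\<lambda>_. ?B))"
    unfolding g_def
  proof (rule measurable_card_step_up)
    fix j assume j: "j \<in> {1..N}"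
    show "(\<lambda>w. ((\<lambda>j. cdf F0 (snd (w j)))(i := 0)) j) \<in> borel_measurable (PiM J (\<lambda>_. ?B))"
    proof (cases "j = i")
      case False
      then have "j \<in> J" using j by (simp add: J_def)
      then have "(\<lambda>w. w j) \<in> PiM J (\<lambda>_. ?B) \<rightarrow>\<^sub>M ?B"
        by (intro measurable_component_singleton)
      from measurable_compose[OF measurable_compose[OF this measurable_snd] measurable_cdf_F0]
      show ?thesis using False by simp
    qed simp
  qed simp
  have ind: "indep_var borel (f \<circ> (\<lambda>\<omega>. restrict (\<lambda>j. ?X j \<omega>) {i}))
      borel (g \<circ> (\<lambda>\<omega>. restrict (\<lambda>j. ?X j \<omega>) J))"
    using i by (intro indep_var_compose[OF indep_var_restrict[OF indep] f g]) (auto simp: J_def)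
  have fX: "f (restrict (\<lambda>j. ?X j \<omega>) {i}) = 1 \<longleftrightarrow> H i \<omega> \<and> cdf F0 (Z i \<omega>) \<le> t" for \<omega>
    by (simp add: f_def)
  \<comment> \<open>Restriction to \<open>J\<close> leaves coordinate \<open>i\<close> undefined,
    but the update overwrites it with 0, and \<open>step_up\<close> reads only coordinates in
    \<open>{1..N}\<close>.\<close>
  have gX: "g (restrict (\<lambda>j. ?X j \<omega>) J) = rejections_at_zero i c \<omega>" for \<omega>
  proof -
    have "l \<in> {1..N} \<Longrightarrow> ((\<lambda>j. cdf F0 (snd (restrict (\<lambda>j. ?X j \<omega>) J j)))(i := 0)) l =
        ((\<lambda>j. cdf F0 (Z j \<omega>))(i := 0)) l" for l
      by (simp add: J_def)
    then have "step_up {1..N} c ((\<lambda>j. cdf F0 (snd (restrict (\<lambda>j. ?X j \<omega>) J j)))(i := 0)) =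
        step_up {1..N} c ((\<lambda>j. cdf F0 (Z j \<omega>))(i := 0))"
      unfolding step_up_def by (intro Collect_cong conj_cong refl) (simp cong: conj_cong)
    then show ?thesis by (simp only: g_def rejections_at_zero_def)
  qed
  show ?thesis
    \<comment> \<open>Since \<open>f\<close> is an indicator, its event is the preimage of the
      singleton \<open>{1}\<close>.\<close>
    using indep_varD[OF ind, of "{1}" "{r}"]
    by (simp add: fX gX vimage_def Int_def conj_commute)
qed

section \<open>The false discovery proportion and its expectation\<close>

text \<open>With the comparison function equal to count / \<open>N\<close>, the ratio test at a
  positive p-value is solved for that p-value; this produces the constant \<alpha> / (\<pi>0
  \<open>N\<close>).\<close>

lemma rejected_eq_step_up:
  assumes ord: "is_ordering N (p_value F0 z) \<tau>" and a: "0 < \<alpha>"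
  shows "rejected N \<pi>0 \<alpha> F0 z \<tau> = step_up {1..N} (\<alpha> / (\<pi>0 * real N)) (p_value F0 z)"
proof -
  have "comparison_ratio N F0 z (p_value F0 z j) \<ge> ereal (\<pi>0 / \<alpha>) \<longleftrightarrow>
      p_value F0 z j \<le> \<alpha> / (\<pi>0 * real N) * real (card {l \<in> {1..N}. p_value F0 z l \<le> p_value F0 z j})"
    if "j \<in> {1..N}" for j
  proof (cases "p_value F0 z j = 0")
    \<comment> \<open>At a zero p-value both sides hold: the ratio is infinite by convention, and
      the right-hand side is nonnegative.\<close>
    case True
    then show ?thesis using pi0_pos a by (simp add: comparison_ratio_def)
  next
    case False
    then have "0 < p_value F0 z j" by (simp add: p_value_def cdf_def less_le)
    moreover have "0 < real N" using that by simp
    ultimately show ?thesis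
      using pi0_pos a False by (simp add: comparison_ratio_def emp_comparison_eq field_simps)
  qed
  then show ?thesis
    unfolding rejected_eq[OF ord] step_up_eq[OF finite_atLeastAtMost] by blast
qed

text \<open>The random denominator is traded for a sum over its possible values \<open>r\<close>.
  For a rejected true null the term with \<open>r = card R\<close> already equals
  \<open>1 / card R\<close>, and all other terms are nonnegative.\<close>

lemma fdp_le_leave_one_out:
  assumes ord: "is_ordering N (p_value F0 (\<lambda>i. Z i \<omega>)) \<tau>" and a: "0 < \<alpha>"
    and c: "c = \<alpha> / (\<pi>0 * real N)" and "\<omega> \<in> space M"
  shows "fdp (\<lambda>i. H i \<omega>) (rejected N \<pi>0 \<alpha> F0 (\<lambda>i. Z i \<omega>) \<tau>) \<le>
    (\<Sum>i = 1..N. \<Sum>r = 1..N. (1 / real r) *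
      indicat_real {\<omega> \<in> space M. (H i \<omega> \<and> cdf F0 (Z i \<omega>) \<le> c * real r) \<and> rejections_at_zero i c \<omega> = real r} \<omega>)"
proof -
  define u where "u = p_value F0 (\<lambda>i. Z i \<omega>)"
  define R where "R = step_up {1..N} c u"
  define T where "T i r = (1 / real r) * indicat_real
      {\<omega> \<in> space M. (H i \<omega> \<and> cdf F0 (Z i \<omega>) \<le> c * real r) \<and> rejections_at_zero i c \<omega> = real r} \<omega>" for i r
  have u: "u = (\<lambda>j. cdf F0 (Z j \<omega>))" by (simp add: u_def p_value_def fun_eq_iff)
  have u0: "0 \<le> u i" for i by (simp add: u cdf_def)
  have c0: "0 \<le> c" using a pi0_pos c by simp
  have sub: "R \<subseteq> {1..N}" by (simp add: R_def step_up_subset)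
  have finR: "finite R" using sub finite_subset by blast
  have T0: "0 \<le> T i r" for i r by (simp add: T_def)
  have *: "1 / real (card R) \<le> (\<Sum>r = 1..N. T i r)" if i: "i \<in> R" "H i \<omega>" for i
  proof -
    have "card R \<le> card {1..N}" using sub by (intro card_mono) auto
    moreover have "card R \<noteq> 0" using finR i by auto
    ultimately have rN: "card R \<in> {1..N}" by simp
    have "rejections_at_zero i c \<omega> = real (card R)"
      using step_up_leave_one_out[OF finite_atLeastAtMost c0 u0 i(1)[unfolded R_def]]
      by (simp add: rejections_at_zero_def R_def u)
    moreover have "cdf F0 (Z i \<omega>) \<le> c * real (card R)"
      using le_step_up[OF finite_atLeastAtMost c0 i(1)[unfolded R_def]] by (simp add: R_def u)
    ultimately have "T i (card R) = 1 / real (card R)"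
      using i \<open>\<omega> \<in> space M\<close> by (simp add: T_def)
    then show ?thesis
      using member_le_sum[of "card R" "{1..N}" "T i"] rN T0 by simp
  qed
  have "rejected N \<pi>0 \<alpha> F0 (\<lambda>i. Z i \<omega>) \<tau> = R"
    by (simp add: rejected_eq_step_up[OF ord a] R_def u_def c)
  then have "fdp (\<lambda>i. H i \<omega>) (rejected N \<pi>0 \<alpha> F0 (\<lambda>i. Z i \<omega>) \<tau>) =
      (\<Sum>i\<in>{i \<in> R. H i \<omega>}. 1 / real (max (card R) 1))"
    by (simp add: fdp_def)
  \<comment> \<open>If \<open>R\<close> is empty both sums are empty; otherwise
    \<open>max (card R) 1\<close> is \<open>card R\<close>.\<close>
  also have "\<dots> = (\<Sum>i\<in>{i \<in> R. H i \<omega>}. 1 / real (card R))"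
  proof (intro sum.cong refl)
    fix i assume "i \<in> {i \<in> R. H i \<omega>}"
    then have "0 < card R" using finR card_gt_0_iff by blast
    then show "1 / real (max (card R) 1) = 1 / real (card R)" by (simp add: max_def)
  qed
  also have "\<dots> \<le> (\<Sum>i\<in>{i \<in> R. H i \<omega>}. \<Sum>r = 1..N. T i r)"
    by (intro sum_mono *) auto
  also have "\<dots> \<le> (\<Sum>i = 1..N. \<Sum>r = 1..N. T i r)"
    using sub T0 by (intro sum_mono2 sum_nonneg) auto
  finally show ?thesis by (simp add: T_def)
qed

lemma sum_prob_rejections_at_zero_le_1: "(\<Sum>r = 1..N. \<P>(\<omega> in M. rejections_at_zero i c \<omega> = real r)) \<le> 1"
proof -
  note [measurable] = measurable_rejections_at_zero
  have "(\<Sum>r = 1..N. \<P>(\<omega> in M. rejections_at_zero i c \<omega> = real r)) =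
      prob (\<Union>r\<in>{1..N}. {\<omega> \<in> space M. rejections_at_zero i c \<omega> = real r})"
    by (intro finite_measure_finite_Union[symmetric])
      (auto simp: disjoint_family_on_def)
  then show ?thesis by simp
qed

theorem FDR_rejected_le:
  assumes N: "N \<ge> 1" and a: "0 < \<alpha>"
    and ord: "\<And>\<omega>. \<omega> \<in> space M \<Longrightarrow> is_ordering N (p_value F0 (\<lambda>i. Z i \<omega>)) (\<sigma> \<omega>)"
  shows "FDR M H (\<lambda>\<omega>. rejected N \<pi>0 \<alpha> F0 (\<lambda>i. Z i \<omega>) (\<sigma> \<omega>)) \<le> \<alpha>"
proof -
  define c where "c = \<alpha> / (\<pi>0 * real N)"
  define E where "E i r = {\<omega> \<in> space M. (H i \<omega> \<and> cdf F0 (Z i \<omega>) \<le> c * real r) \<and>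
      rejections_at_zero i c \<omega> = real r}" for i r
  have c0: "0 \<le> c" using a pi0_pos by (simp add: c_def)
  have E: "E i r \<in> sets M" if "i \<in> {1..N}" for i r
  proof -
    note [measurable] = measurable_null[OF that] measurable_stat[OF that] measurable_cdf_F0
      measurable_rejections_at_zero
    show ?thesis unfolding E_def by measurable
  qed
  have int: "integrable M (\<lambda>\<omega>. (1 / real r) * indicat_real (E i r) \<omega>)" if "i \<in> {1..N}" for i r
    using E[OF that] by (intro integrable_mult_right integrable_real_indicator)
      (auto simp: emeasure_eq_measure)
  have "FDR M H (\<lambda>\<omega>. rejected N \<pi>0 \<alpha> F0 (\<lambda>i. Z i \<omega>) (\<sigma> \<omega>)) \<le>
      (\<integral>\<omega>. (\<Sum>i = 1..N. \<Sum>r = 1..N. (1 / real r) * indicat_real (E i r) \<omega>) \<partial>M)"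
    unfolding FDR_def
  proof (rule integral_mono)
    show "integrable M (\<lambda>\<omega>. fdp (\<lambda>i. H i \<omega>) (rejected N \<pi>0 \<alpha> F0 (\<lambda>i. Z i \<omega>) (\<sigma> \<omega>)))"
      by (rule integrable_fdp[OF ord])
    show "integrable M (\<lambda>\<omega>. \<Sum>i = 1..N. \<Sum>r = 1..N. (1 / real r) * indicat_real (E i r) \<omega>)"
      by (intro Bochner_Integration.integrable_sum int)
  qed (auto simp only: E_def intro!: fdp_le_leave_one_out ord a c_def)
  also have "\<dots> = (\<Sum>i = 1..N. \<Sum>r = 1..N. (1 / real r) * prob (E i r))"
  proof (subst Bochner_Integration.integral_sum)
    show "(\<Sum>i = 1..N. \<integral>\<omega>. (\<Sum>r = 1..N. (1 / real r) * indicat_real (E i r) \<omega>) \<partial>M) =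
        (\<Sum>i = 1..N. \<Sum>r = 1..N. (1 / real r) * prob (E i r))"
    proof (intro sum.cong refl)
      fix i assume i: "i \<in> {1..N}"
      show "(\<integral>\<omega>. (\<Sum>r = 1..N. (1 / real r) * indicat_real (E i r) \<omega>) \<partial>M) =
          (\<Sum>r = 1..N. (1 / real r) * prob (E i r))"
        using int[OF i] E[OF i] by (subst Bochner_Integration.integral_sum) auto
    qed
  qed (intro Bochner_Integration.integrable_sum int)
  also have "\<dots> \<le> (\<Sum>i = 1..N. \<Sum>r = 1..N. \<pi>0 * c * \<P>(\<omega> in M. rejections_at_zero i c \<omega> = real r))"
  proof (intro sum_mono)
    fix i r assume i: "i \<in> {1..N}" and r: "r \<in> {1..N}"
    \<comment> \<open>Independence factors the event, and the null p-value bound is applied at the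
      level \<open>c * real r\<close>.\<close>
    have "prob (E i r) \<le> (\<pi>0 * (c * real r)) * \<P>(\<omega> in M. rejections_at_zero i c \<omega> = real r)"
      unfolding E_def prob_null_rejections_at_zero[OF i] using c0
      by (intro mult_right_mono prob_null_p_value_le[OF i]) auto
    then have "(1 / real r) * prob (E i r) \<le>
        (1 / real r) * ((\<pi>0 * (c * real r)) * \<P>(\<omega> in M. rejections_at_zero i c \<omega> = real r))"
      by (intro mult_left_mono) auto
    \<comment> \<open>The level is proportional to \<open>r\<close>, which cancels the weight
      \<open>1 / r\<close>; what remains sums over \<open>r\<close> to at most
      \<open>\<pi>0 * c\<close>.\<close>
    also have "\<dots> = \<pi>0 * c * \<P>(\<omega> in M. rejections_at_zero i c \<omega> = real r)"
      using r by simp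
    finally show "(1 / real r) * prob (E i r) \<le> \<pi>0 * c * \<P>(\<omega> in M. rejections_at_zero i c \<omega> = real r)" .
  qed
  also have "\<dots> \<le> (\<Sum>i = 1..N. \<pi>0 * c * 1)"
    unfolding sum_distrib_left[symmetric] using c0 pi0_pos
    by (intro sum_mono mult_left_mono sum_prob_rejections_at_zero_le_1) auto
  \<comment> \<open>The choice of \<open>c\<close> makes \<open>\<pi>0 * c\<close> equal to \<alpha>
    / \<open>N\<close>, one equal share for each hypothesis.\<close>
  also have "\<dots> = \<alpha>" using N pi0_pos by (simp add: c_def)
  finally show ?thesis .
qed

end

theorem theorem1:
  fixes M :: "'a measure" and N :: nat and \<pi>0 \<alpha> :: real and F0 G :: "real measure"
    and H :: "nat \<Rightarrow> 'a \<Rightarrow> bool" and Z :: "nat \<Rightarrow> 'a \<Rightarrow> real" and \<sigma> :: "'a \<Rightarrow> nat \<Rightarrow> nat"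
  assumes "N \<ge> 1" and "0 < \<alpha>" and "\<alpha> < 1"
    and "mixed_sample M N \<pi>0 F0 G H Z"
    and "\<And>\<omega>. \<omega> \<in> space M \<Longrightarrow> is_ordering N (p_value F0 (\<lambda>i. Z i \<omega>)) (\<sigma> \<omega>)"
  shows "FDR M H (\<lambda>\<omega>. rejected N \<pi>0 \<alpha> F0 (\<lambda>i. Z i \<omega>) (\<sigma> \<omega>)) \<le> \<alpha>"
  using mixed_sample.FDR_rejected_le[OF assms(4,1,2,5)] .

end
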